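(* Let $r\ge 3$ and $k\ge 0$ be integers. If $\mathcal{H}$ is a connected $r$-uniform hypergraph with $n$ vertices and $m$ edges, where $k+r\le n$, then $$\gamma_p^k(\mathcal{H}) \leq \frac{n + \left\lfloor \frac{r-3}{2}\right\rfloor m}{\left\lfloor \frac{3(r-1)}{2}\right\rfloor+k}.$$
   Context: A (finite) hypergraph $\mathcal{H}=(V,E)$ is a finite set of vertices $V$ together with a set of edges $E$ that is a subset of the power set of $V$. It is $r$-uniform if every edge has exactly $r$ vertices. Two distinct vertices are adjacent (neighbors) if some edge contains both. It is connected if any two vertices are joined by a path of consecutively adjacent vertices. For $v\in V$, the closed neighborhood $N[v]$ consists of $v$ and all vertices adjacent to $v$; for $S\subseteq V$, $N[S]=\bigcup_{v\in S}N[v]$. A set $D\subseteq V$ colors vertices blue by the following process (vertices that are not blue are white). (1) Domination step: all vertices in $N[D]$ are colored blue. (2) Forcing step, applied repeatedly: given a blue vertex $v$, if there is a set of at most $k$ edges, each incident with $v$, that together contain all of $v$'s white neighbors, then these white neighbors turn blue. If iteratively applying these rules makes all vertices blue, then $D$ is a $k$-power dominating set of $\mathcal{H}$. The $k$-power domination number $\gamma_p^k(\mathcal{H})$ is the minimum cardinality of a $k$-power dominating set of $\mathcal{H}$. *)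

theory Defs
  imports Complex_Main
begin

text \<open>A hypergraph is given by its vertex set \<open>V\<close> and its edge set \<open>E\<close>.\<close>

definition hypergraph :: "'a set \<Rightarrow> 'a set set \<Rightarrow> bool" where
  "hypergraph V E \<longleftrightarrow> finite V \<and> E \<subseteq> Pow V"

definition uniform :: "nat \<Rightarrow> 'a set set \<Rightarrow> bool" where
  "uniform r E \<longleftrightarrow> (\<forall>e\<in>E. card e = r)"

definition adjacent :: "'a set set \<Rightarrow> 'a \<Rightarrow> 'a \<Rightarrow> bool" where
  "adjacent E u v \<longleftrightarrow> u \<noteq> v \<and> (\<exists>e\<in>E. u \<in> e \<and> v \<in> e)"

definition connected_hypergraph :: "'a set \<Rightarrow> 'a set set \<Rightarrow> bool" where
  "connected_hypergraph V E \<longleftrightarrow> (\<forall>u\<in>V. \<forall>v\<in>V. (adjacent E)\<^sup>*\<^sup>* u v)"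

definition neighbors :: "'a set set \<Rightarrow> 'a \<Rightarrow> 'a set" where
  "neighbors E v = {u. adjacent E v u}"

definition closed_neighborhood :: "'a set set \<Rightarrow> 'a set \<Rightarrow> 'a set" where
  "closed_neighborhood E S = (\<Union>v\<in>S. insert v (neighbors E v))"

text \<open>One application of the forcing rule takes the set \<open>B\<close> of blue vertices to \<open>B'\<close>;
  the white neighbors of \<open>v\<close> are \<open>neighbors E v - B\<close>.\<close>

definition forcing_step :: "'a set set \<Rightarrow> nat \<Rightarrow> 'a set \<Rightarrow> 'a set \<Rightarrow> bool" where
  "forcing_step E k B B' \<longleftrightarrow>
     (\<exists>v\<in>B. (\<exists>F\<subseteq>E. finite F \<and> card F \<le> k \<and> (\<forall>e\<in>F. v \<in> e) \<and> neighbors E v - B \<subseteq> \<Union>F) \<and>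
       B' = B \<union> (neighbors E v - B))"

definition power_dominating :: "'a set \<Rightarrow> 'a set set \<Rightarrow> nat \<Rightarrow> 'a set \<Rightarrow> bool" where
  "power_dominating V E k D \<longleftrightarrow>
     D \<subseteq> V \<and> (forcing_step E k)\<^sup>*\<^sup>* (closed_neighborhood E D) V"

definition power_domination_number :: "'a set \<Rightarrow> 'a set set \<Rightarrow> nat \<Rightarrow> nat" where
  "power_domination_number V E k = (LEAST d. \<exists>D. power_dominating V E k D \<and> card D = d)"

text \<open>The minimum is over a nonempty set, since \<open>V\<close> itself is always admissible.\<close>

lemma power_dominating_vertices:
  assumes "hypergraph V E"
  shows "power_dominating V E k V"
proof -
  have "closed_neighborhood E V = V"
    using assms
    by (auto simp: hypergraph_def closed_neighborhood_def neighbors_def adjacent_def)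
  then show ?thesis
    by (simp add: power_dominating_def)
qed

end

theory Submission
  imports Defs
begin

text \<open>Write \<open>c = (r - 3) div 2\<close>, so that the denominator is \<open>r + c + k\<close>. Take a minimum
  \<open>k\<close>-power dominating set \<open>S\<close> in which no vertex has its private neighbors covered by \<open>k\<close> of its
  edges. Around every vertex of \<open>S\<close> one can set \<open>k\<close> edges aside so that the remaining edges \<open>A\<close> of
  minimal covers of the neighborhoods avoid \<open>k * card S\<close> vertices, and any set meeting all edges of
  \<open>A\<close> is again \<open>k\<close>-power dominating, the edges set aside being recovered by forcing. Every edge
  of \<open>A\<close> has a vertex in no other edge of \<open>A\<close>; after deleting these vertices the theorem of
  Chvatal and McDiarmid on transversals of \<open>(r - 1)\<close>-uniform hypergraphs gives a set meeting all
  edges of \<open>A\<close>, of size at most \<open>(n - k * card S + c * m) / (r + c)\<close>. It has at least \<open>card S\<close>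
  elements by minimality.\<close>

subsection \<open>Matchings in multigraphs\<close>

text \<open>Edges are labels with end sets attached, so parallel edges are allowed. They do occur in
  the application, where the labels are points and the nodes are sets: two points may lie in the
  same two sets.\<close>

definition matching :: "('b \<Rightarrow> 'a set) \<Rightarrow> 'b set \<Rightarrow> 'b set \<Rightarrow> bool" where
  "matching ends X M \<longleftrightarrow> M \<subseteq> X \<and> (\<forall>x\<in>M. \<forall>y\<in>M. x \<noteq> y \<longrightarrow> ends x \<inter> ends y = {})"

definition maximum_matching :: "('b \<Rightarrow> 'a set) \<Rightarrow> 'b set \<Rightarrow> 'b set \<Rightarrow> bool" where
  "maximum_matching ends X M \<longleftrightarrow>
     matching ends X M \<and> (\<forall>M'. matching ends X M' \<longrightarrow> card M' \<le> card M)"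

lemma maximum_matching_exists:
  assumes "finite X"
  shows "\<exists>M. maximum_matching ends X M"
proof -
  have "\<exists>M. matching ends X M \<and> (\<forall>M'. matching ends X M' \<longrightarrow> card M' \<le> card M)"
  proof (rule ex_has_greatest_nat)
    show "matching ends X {}" by (simp add: matching_def)
    show "\<forall>M. matching ends X M \<longrightarrow> card M < Suc (card X)"
      using assms by (auto simp: matching_def less_Suc_eq_le intro: card_mono)
  qed
  then show ?thesis by (simp add: maximum_matching_def)
qed

lemma card_matched_nodes:
  assumes "matching ends X M" "finite X" "\<And>x. x \<in> X \<Longrightarrow> card (ends x) = 2"
  shows "card (\<Union>(ends ` M)) = 2 * card M"
proof -
  have "M \<subseteq> X" using assms(1) by (simp add: matching_def)
  then have fin: "finite M" using assms(2) finite_subset by blast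
  have "card (\<Union>(ends ` M)) = (\<Sum>x\<in>M. card (ends x))"
  proof (rule card_UN_disjoint[OF fin])
    show "\<forall>x\<in>M. finite (ends x)"
      using assms(3) \<open>M \<subseteq> X\<close> by (auto intro!: card_ge_0_finite simp: subset_iff)
  qed (use assms(1) in \<open>simp add: matching_def\<close>)
  also have "\<dots> = (\<Sum>x\<in>M. 2)"
    using \<open>M \<subseteq> X\<close> by (intro sum.cong refl assms(3)) auto
  finally show ?thesis by simp
qed

lemma maximum_matching_meets_edge:
  assumes "maximum_matching ends X M" "finite X" "x \<in> X" "ends x \<noteq> {}"
  shows "ends x \<inter> \<Union>(ends ` M) \<noteq> {}"
proof
  assume disj: "ends x \<inter> \<Union>(ends ` M) = {}"
  have "x \<notin> M" using disj assms(4) by auto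
  have "matching ends X (insert x M)"
    using assms disj by (auto simp: maximum_matching_def matching_def)
  then have "card (insert x M) \<le> card M"
    using assms(1) by (simp add: maximum_matching_def)
  moreover have "finite M"
    using assms(1,2) by (auto simp: maximum_matching_def matching_def intro: finite_subset)
  ultimately show False using \<open>x \<notin> M\<close> by simp
qed

text \<open>Gallai's lemma: among the maximum matchings missing \<open>t\<close> take one, \<open>N\<close>, sharing as many
  edges with \<open>M\<close> as possible. Then \<open>N\<close> can be switched along an edge of \<open>M\<close> to share one more.\<close>

lemma gallai:
  assumes fin: "finite X" and two: "\<And>x. x \<in> X \<Longrightarrow> card (ends x) = 2"
    and M: "maximum_matching ends X M" and uv: "u \<noteq> v"
    and Mu: "u \<notin> \<Union>(ends ` M)" and Mv: "v \<notin> \<Union>(ends ` M)"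
    and t: "\<exists>N. maximum_matching ends X N \<and> t \<notin> \<Union>(ends ` N)"
    and ut: "\<And>N. maximum_matching ends X N \<Longrightarrow> t \<notin> \<Union>(ends ` N) \<Longrightarrow> u \<in> \<Union>(ends ` N)"
    and vt: "\<And>N. maximum_matching ends X N \<Longrightarrow> t \<notin> \<Union>(ends ` N) \<Longrightarrow> v \<in> \<Union>(ends ` N)"
  shows False
proof -
  let ?P = "\<lambda>N. maximum_matching ends X N \<and> t \<notin> \<Union>(ends ` N)"
  have MX: "M \<subseteq> X" using M by (simp add: maximum_matching_def matching_def)
  then have finM: "finite M" using fin finite_subset by blast
  obtain N where N: "?P N" and best: "\<And>N'. ?P N' \<Longrightarrow> card (M \<inter> N') \<le> card (M \<inter> N)"
  proof -
    obtain N0 where "?P N0" using t by blast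
    moreover have "\<forall>N. ?P N \<longrightarrow> card (M \<inter> N) < Suc (card M)"
      using finM by (simp add: card_mono less_Suc_eq_le)
    ultimately have "\<exists>N. ?P N \<and> (\<forall>N'. ?P N' \<longrightarrow> card (M \<inter> N') \<le> card (M \<inter> N))"
      by (rule ex_has_greatest_nat)
    then show ?thesis using that by blast
  qed
  have NX: "N \<subseteq> X" and mN: "matching ends X N"
    using N by (simp_all add: maximum_matching_def matching_def)
  have finN: "finite N" using NX fin finite_subset by blast
  have finends: "finite (ends x)" if "x \<in> X" for x
    using two[OF that] by (simp add: card_ge_0_finite)
  let ?CM = "\<Union>(ends ` M)" and ?CN = "\<Union>(ends ` N)"
  have finCM: "finite ?CM" and finCN: "finite ?CN"
    using finM finN MX NX finends by auto
  \<comment> \<open>Both matchings cover equally many nodes, and \<open>N\<close> covers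
    \<open>u\<close> and \<open>v\<close>, which \<open>M\<close> misses. So \<open>M\<close> covers
    at least two nodes missed by \<open>N\<close>, and one of them differs from
    \<open>t\<close>.\<close>
  have "card M = card N"
    using M N by (meson maximum_matching_def le_antisym)
  then have "card ?CM = card ?CN"
    using card_matched_nodes[OF _ fin two] M mN by (simp add: maximum_matching_def)
  then have eq: "card (?CM - ?CN) = card (?CN - ?CM)"
    using finCM finCN by (metis card_le_sym_Diff le_antisym order_refl)
  have "{u, v} \<subseteq> ?CN - ?CM" using ut vt N Mu Mv by blast
  then have "card {u, v} \<le> card (?CN - ?CM)" using finCN by (intro card_mono) auto
  then have "2 \<le> card (?CM - ?CN)" using uv eq by simp
  then have "\<not> ?CM - ?CN \<subseteq> {t}"
    using card_mono[of "{t}" "?CM - ?CN"] by auto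
  then obtain x a where a: "a \<in> M" "x \<in> ends a" and x: "x \<notin> ?CN" "x \<noteq> t" by auto
  have "a \<in> X" using a MX by blast
  then obtain y where y: "ends a = {x, y}" "x \<noteq> y"
    using two[of a] a(2) by (auto simp: card_2_iff doubleton_eq_iff)
  have aN: "a \<notin> N" using a(2) x by blast
  have "y \<in> ?CN"
    using maximum_matching_meets_edge[of ends X N a] N fin \<open>a \<in> X\<close> y x by auto
  then obtain b where b: "b \<in> N" "y \<in> ends b" by blast
  have "b \<noteq> a" using aN b by blast
  have "y \<in> ends a \<inter> ends b" using b y by simp
  moreover have "\<forall>p\<in>M. \<forall>q\<in>M. p \<noteq> q \<longrightarrow> ends p \<inter> ends q = {}"
    using M by (simp add: maximum_matching_def matching_def)
  ultimately have bM: "b \<notin> M" using a(1) \<open>b \<noteq> a\<close> by blast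
  \<comment> \<open>Since \<open>b\<close> is not in \<open>M\<close>, switching \<open>b\<close>
    for \<open>a\<close> gains a common edge with \<open>M\<close>. The node \<open>t\<close> stays
    missed because \<open>x \<noteq> t\<close>, while \<open>y\<close> is covered by
    \<open>N\<close> and \<open>t\<close> is not.\<close>
  let ?N' = "insert a (N - {b})"
  have yb: "y \<notin> ends z" if "z \<in> N - {b}" for z
    using that b mN by (auto simp: matching_def)
  have "matching ends X ?N'"
    unfolding matching_def
  proof (intro conjI ballI impI)
    show "?N' \<subseteq> X" using NX \<open>a \<in> X\<close> by blast
    fix p q assume "p \<in> ?N'" "q \<in> ?N'" "p \<noteq> q"
    then consider "p = a" "q \<in> N - {b}" | "q = a" "p \<in> N - {b}" | "p \<in> N" "q \<in> N"
      by blast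
    then show "ends p \<inter> ends q = {}"
    proof cases
      case 1 then show ?thesis using y x yb by auto
    next
      case 2 then show ?thesis using y x yb by auto
    next
      case 3 then show ?thesis using mN \<open>p \<noteq> q\<close> by (auto simp: matching_def)
    qed
  qed
  moreover have "card ?N' = card N"
    using aN b(1) finN by (metis DiffD1 card_Suc_Diff1 card_insert_disjoint finite_Diff)
  ultimately have "maximum_matching ends X ?N'"
    using N by (simp add: maximum_matching_def)
  moreover have "t \<notin> \<Union>(ends ` ?N')"
    using N x y \<open>y \<in> ?CN\<close> by auto
  ultimately have "card (M \<inter> ?N') \<le> card (M \<inter> N)" using best by blast
  moreover have "M \<inter> ?N' = insert a (M \<inter> N)" using a bM by blast
  ultimately show False using aN finM by simp
qed

lemma double_count:
  assumes "finite A" "finite B"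
  shows "(\<Sum>a\<in>A. card {b \<in> B. R a b}) = (\<Sum>b\<in>B. card {a \<in> A. R a b})"
  using sum.swap_restrict[OF assms, of "\<lambda>_ _. 1::nat" R] by simp

text \<open>This also follows from Shannon's edge colouring theorem. Deleting a node that every maximum
  matching covers lowers the matching number; if there is no such node, Gallai's lemma says that
  a component with \<open>c\<close> nodes contains \<open>(c - 1) / 2\<close> edges of each maximum matching.\<close>

lemma card_le_matching:
  assumes "finite X" "\<And>x. x \<in> X \<Longrightarrow> card (ends x) = 2"
    and "\<And>v. card {x \<in> X. v \<in> ends x} \<le> s"
  shows "\<exists>M. matching ends X M \<and> card X \<le> (s + s div 2) * card M"
  using assms
proof (induction "card X" arbitrary: X rule: less_induct)
  case less
  note fin = less.prems(1) and two = less.prems(2) and deg = less.prems(3)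
  have finends: "finite (ends x)" if "x \<in> X" for x
    using two[OF that] by (simp add: card_ge_0_finite)
  have IH: "\<exists>M. matching ends X' M \<and> card X' \<le> (s + s div 2) * card M" if "X' \<subset> X" for X'
  proof (rule less.hyps)
    show "card X' < card X" using that fin by (rule psubset_card_mono[rotated])
    show "finite X'" using that fin finite_subset by blast
    show "card (ends x) = 2" if "x \<in> X'" for x using two that \<open>X' \<subset> X\<close> by blast
    show "card {x \<in> X'. v \<in> ends x} \<le> s" for v
      using card_mono[of "{x \<in> X. v \<in> ends x}" "{x \<in> X'. v \<in> ends x}"] fin that deg[of v]
      by fastforce
  qed
  obtain M where M: "maximum_matching ends X M"
    using maximum_matching_exists fin by blast
  have MX: "M \<subseteq> X" using M by (simp add: maximum_matching_def matching_def)
  show ?case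
  proof (cases "X = {}")
    case True
    then show ?thesis by (auto simp: matching_def)
  next
    case False
    then obtain x0 u0 where x0: "x0 \<in> X" "u0 \<in> ends x0"
      by (metis all_not_in_conv card.empty two zero_neq_numeral)
    show ?thesis
    proof (cases "\<exists>v \<in> \<Union>(ends ` X). \<forall>N. maximum_matching ends X N \<longrightarrow> v \<in> \<Union>(ends ` N)")
      case True
      then obtain v where v: "v \<in> \<Union>(ends ` X)"
        and cov: "\<And>N. maximum_matching ends X N \<Longrightarrow> v \<in> \<Union>(ends ` N)" by blast
      define X' where "X' = {x \<in> X. v \<notin> ends x}"
      have "X' \<subset> X" using v by (auto simp: X'_def)
      then obtain M' where M': "matching ends X' M'" "card X' \<le> (s + s div 2) * card M'"
        using IH by blast
      have mM': "matching ends X M'" using M'(1) \<open>X' \<subset> X\<close> by (auto simp: matching_def)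
      have "v \<notin> \<Union>(ends ` M')" using M'(1) by (auto simp: matching_def X'_def)
      then have "\<not> maximum_matching ends X M'" using cov by blast
      then have "card M' < card M"
        using mM' M unfolding maximum_matching_def by (metis not_less le_trans)
      have "X = {x \<in> X. v \<in> ends x} \<union> X'" by (auto simp: X'_def)
      then have "card X \<le> card {x \<in> X. v \<in> ends x} + card X'"
        by (metis card_Un_le)
      also have "\<dots> \<le> (s + s div 2) * Suc (card M')"
        using deg[of v] M'(2) by simp
      also have "\<dots> \<le> (s + s div 2) * card M"
        using \<open>card M' < card M\<close> by (intro mult_le_mono2) simp
      finally show ?thesis using M by (auto simp: maximum_matching_def)
    next
      case False
      then have missed: "\<exists>N. maximum_matching ends X N \<and> v \<notin> \<Union>(ends ` N)"
        if "v \<in> \<Union>(ends ` X)" for v using that by blast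
      \<comment> \<open>No maximum matching misses two related distinct nodes. Gallai's lemma, with
        \<open>t\<close> the middle node, is exactly transitivity.\<close>
      define sim where "sim u v \<longleftrightarrow> u = v \<or>
        (\<forall>N. maximum_matching ends X N \<longrightarrow> u \<in> \<Union>(ends ` N) \<or> v \<in> \<Union>(ends ` N))" for u v
      have sim_sym: "sim v u" if "sim u v" for u v
        using that by (auto simp: sim_def)
      have sim_trans: "sim u v" if "sim u w" "sim w v" "w \<in> \<Union>(ends ` X)" for u v w
      proof (rule ccontr)
        assume "\<not> sim u v"
        then obtain N where N: "maximum_matching ends X N" "u \<noteq> v"
          "u \<notin> \<Union>(ends ` N)" "v \<notin> \<Union>(ends ` N)" by (auto simp: sim_def)
        show False
        proof (rule gallai[OF fin two N missed[OF that(3)]])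
          fix N' assume N': "maximum_matching ends X N'" "w \<notin> \<Union>(ends ` N')"
          show "u \<in> \<Union>(ends ` N')" "v \<in> \<Union>(ends ` N')"
            using that(1,2) N N' unfolding sim_def by metis+
        qed
      qed
      have sim_edge: "sim u v" if "x \<in> X" "u \<in> ends x" "v \<in> ends x" for x u v
      proof -
        have "ends x = {u, v}" if "u \<noteq> v"
          using two[OF \<open>x \<in> X\<close>] \<open>u \<in> ends x\<close> \<open>v \<in> ends x\<close> that
          by (auto simp: card_2_iff)
        then have "u \<in> \<Union>(ends ` N) \<or> v \<in> \<Union>(ends ` N)"
          if "maximum_matching ends X N" "u \<noteq> v" for N
          using maximum_matching_meets_edge[OF that(1) fin \<open>x \<in> X\<close>] that(2) by auto
        then show ?thesis unfolding sim_def by blast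
      qed
      \<comment> \<open>Ends of an edge are related, so this class is a union of components. Every
        edge meeting it lies inside it, and \<open>M\<close> misses at most one of its
        nodes.\<close>
      define C where "C = {v \<in> \<Union>(ends ` X). sim u0 v}"
      define XC where "XC = {x \<in> X. ends x \<subseteq> C}"
      have in_XC: "x \<in> XC" if "x \<in> X" "v \<in> ends x" "v \<in> C" for x v
      proof -
        have "w \<in> C" if "w \<in> ends x" for w
          using sim_trans[of u0 v w] sim_edge[of x v w] that \<open>x \<in> X\<close> \<open>v \<in> ends x\<close> \<open>v \<in> C\<close>
          by (auto simp: C_def)
        then show ?thesis using \<open>x \<in> X\<close> by (auto simp: XC_def)
      qed
      have "u0 \<in> C" using x0 by (auto simp: C_def sim_def)
      then have x0C: "x0 \<in> XC" using in_XC x0 by blast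
      have finC: "finite C" using fin finends by (auto simp: C_def)
      define MC where "MC = M \<inter> XC"
      have finMC: "finite MC" using MX fin by (auto simp: MC_def intro: finite_subset)
      have "card (C - \<Union>(ends ` M)) \<le> 1"
      proof -
        have "p = q" if "p \<in> C - \<Union>(ends ` M)" "q \<in> C - \<Union>(ends ` M)" for p q
        proof -
          have "sim p q"
            using sim_trans[of p u0 q] sim_sym that x0 by (auto simp: C_def)
          then show ?thesis using that M by (auto simp: sim_def)
        qed
        then show ?thesis using finC by (simp add: card_le_Suc0_iff_eq)
      qed
      moreover have "C \<subseteq> \<Union>(ends ` MC) \<union> (C - \<Union>(ends ` M))"
        using in_XC MX by (auto simp: MC_def)
      then have "card C \<le> card (\<Union>(ends ` MC) \<union> (C - \<Union>(ends ` M)))"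
        using finC finMC MX finends by (intro card_mono) (auto simp: MC_def)
      then have "card C \<le> card (\<Union>(ends ` MC)) + card (C - \<Union>(ends ` M))"
        using card_Un_le le_trans by blast
      moreover have "matching ends X MC"
        using M by (auto simp: MC_def maximum_matching_def matching_def)
      then have "card (\<Union>(ends ` MC)) = 2 * card MC"
        using card_matched_nodes fin two by blast
      ultimately have cardC: "card C \<le> 2 * card MC + 1" by linarith
      have "2 * card XC = (\<Sum>x\<in>XC. card {v \<in> C. v \<in> ends x})"
      proof -
        have "{v \<in> C. v \<in> ends x} = ends x" if "x \<in> XC" for x using that by (auto simp: XC_def)
        then have "(\<Sum>x\<in>XC. card {v \<in> C. v \<in> ends x}) = (\<Sum>x\<in>XC. 2)"
          using two by (intro sum.cong) (auto simp: XC_def)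
        then show ?thesis by simp
      qed
      also have "\<dots> = (\<Sum>v\<in>C. card {x \<in> XC. v \<in> ends x})"
        using fin finC by (intro double_count) (auto simp: XC_def)
      also have "\<dots> \<le> (\<Sum>v\<in>C. s)"
      proof (rule sum_mono)
        fix v
        have "card {x \<in> XC. v \<in> ends x} \<le> card {x \<in> X. v \<in> ends x}"
          using fin by (intro card_mono) (auto simp: XC_def)
        then show "card {x \<in> XC. v \<in> ends x} \<le> s" using deg[of v] by simp
      qed
      also have "\<dots> \<le> (2 * card MC + 1) * s"
        using mult_le_mono1[OF cardC] by simp
      \<comment> \<open>The one missed node costs the extra \<open>s div 2\<close>, which is
        absorbed because \<open>MC\<close> is nonempty: the class contains both ends of
        \<open>x0\<close>, while \<open>card C \<le> 2 * card MC + 1\<close>.\<close>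
      finally have "card XC \<le> s * card MC + s div 2" by (simp add: algebra_simps)
      moreover have "MC \<noteq> {}"
      proof
        assume "MC = {}"
        then have "card C \<le> 1" using cardC by simp
        moreover have "card (ends x0) \<le> card C"
          using x0C finC by (intro card_mono) (auto simp: XC_def)
        ultimately show False using two x0 by simp
      qed
      then have "1 \<le> card MC" using finMC by (simp add: Suc_leI card_gt_0_iff)
      then have "s div 2 \<le> s div 2 * card MC" by simp
      ultimately have cardXC: "card XC \<le> (s + s div 2) * card MC"
        unfolding add_mult_distrib by linarith
      have "X - XC \<subset> X" using x0C x0 by blast
      then obtain M' where M': "matching ends (X - XC) M'"
        "card (X - XC) \<le> (s + s div 2) * card M'" using IH by blast
      have sep: "ends x \<inter> ends y = {}" if "x \<in> XC" "y \<in> X - XC" for x y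
        using that in_XC by (auto simp: XC_def)
      have "matching ends X (MC \<union> M')"
        unfolding matching_def
      proof (intro conjI ballI impI)
        show "MC \<union> M' \<subseteq> X" using MX M'(1) by (auto simp: MC_def matching_def)
        fix x y assume xy: "x \<in> MC \<union> M'" "y \<in> MC \<union> M'" "x \<noteq> y"
        have "MC \<subseteq> M" "MC \<subseteq> XC" "M' \<subseteq> X - XC"
          using M'(1) by (auto simp: MC_def matching_def)
        with xy consider "x \<in> M" "y \<in> M" | "x \<in> M'" "y \<in> M'"
          | "x \<in> XC" "y \<in> X - XC" | "y \<in> XC" "x \<in> X - XC" by blast
        then show "ends x \<inter> ends y = {}"
        proof cases
          case 1
          then show ?thesis using M xy(3) by (auto simp: maximum_matching_def matching_def)
        next
          case 2
          then show ?thesis using M'(1) xy(3) by (auto simp: matching_def)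
        next
          case 3
          then show ?thesis by (rule sep)
        next
          case 4
          then show ?thesis using sep by (metis Int_commute)
        qed
      qed
      moreover have "card X = card XC + card (X - XC)"
        using fin by (metis (no_types, lifting) XC_def card_Diff_subset card_mono finite_subset
            le_add_diff_inverse mem_Collect_eq subsetI)
      moreover have "card (MC \<union> M') = card MC + card M'"
        using M'(1) fin finMC
        by (intro card_Un_disjoint) (auto simp: matching_def MC_def intro: finite_subset)
      ultimately show ?thesis using cardXC M'(2)
        by (intro exI[of _ "MC \<union> M'"]) (simp add: algebra_simps)
    qed
  qed
qed

subsection \<open>Transversals of uniform families\<close>

text \<open>The Chvatal-McDiarmid bound for uniform families. A point of degree at least 3 can be put
  into the transversal and removed. In maximum degree 2, the points of degree 2 are the edges of a
  multigraph on \<open>A\<close>, and a matching of size \<open>\<nu>\<close> there yields a transversal of size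
  \<open>card A - \<nu>\<close>.\<close>

lemma small_transversal_degree_2:
  assumes fin: "finite U" "finite A" and sub: "\<Union>A \<subseteq> U"
    and unif: "\<And>e. e \<in> A \<Longrightarrow> card e = s" and "s > 0"
    and deg: "\<And>u. card {e \<in> A. u \<in> e} \<le> 2"
  shows "\<exists>T\<subseteq>U. (\<forall>e\<in>A. T \<inter> e \<noteq> {}) \<and> (s + s div 2) * card T \<le> card U + s div 2 * card A"
proof -
  define X where "X = {u \<in> U. card {e \<in> A. u \<in> e} = 2}"
  define ends where "ends u = {e \<in> A. u \<in> e}" for u
  have "card {x \<in> X. e \<in> ends x} \<le> s" for e
  proof (cases "e \<in> A")
    case True
    have "card {x \<in> X. e \<in> ends x} \<le> card e"
      using True sub fin by (intro card_mono) (auto simp: ends_def intro: finite_subset)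
    then show ?thesis using unif[OF True] by simp
  qed (simp add: ends_def)
  then obtain M where M: "matching ends X M" "card X \<le> (s + s div 2) * card M"
    using card_le_matching[of X ends s] fin by (auto simp: X_def ends_def)
  have MX: "M \<subseteq> X" using M(1) by (simp add: matching_def)
  have finM: "finite M" using MX fin by (auto simp: X_def intro: finite_subset)
  \<comment> \<open>A point of \<open>M\<close> meets two sets, and no set is met by two points of
    \<open>M\<close>. Each set left over receives one point of its own, so \<open>card T\<close> is
    at most \<open>card A - card M\<close>.\<close>
  define R where "R = A - \<Union>(ends ` M)"
  have "\<Union>(ends ` M) \<subseteq> A" by (auto simp: ends_def)
  moreover have "card (\<Union>(ends ` M)) = 2 * card M"
    using M(1) fin by (intro card_matched_nodes[of ends X]) (auto simp: X_def ends_def)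
  ultimately have cardA: "card A = card R + 2 * card M"
    using fin(2) card_mono[of A "\<Union>(ends ` M)"]
    by (simp add: R_def card_Diff_subset finite_subset)
  have ne: "e \<noteq> {}" if "e \<in> A" for e using unif[OF that] \<open>s > 0\<close> by auto
  define pick where "pick e = (SOME u. u \<in> e)" for e :: "'a set"
  have pick: "pick e \<in> e" if "e \<in> A" for e
    using ne[OF that] by (simp add: pick_def some_in_eq)
  define T where "T = M \<union> pick ` R"
  have "T \<subseteq> U" using MX pick sub by (auto simp: T_def X_def R_def)
  moreover have "T \<inter> e \<noteq> {}" if "e \<in> A" for e
  proof (cases "e \<in> R")
    case True
    then show ?thesis using pick[OF that] by (auto simp: T_def)
  next
    case False
    then show ?thesis using that by (auto simp: T_def R_def ends_def)
  qed
  moreover have "(s + s div 2) * card T \<le> card U + s div 2 * card A"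
  proof -
    have "card T \<le> card M + card R"
      using fin(2) unfolding T_def R_def
      by (meson add_left_mono card_Un_le card_image_le finite_Diff le_trans)
    then have "card T + card M \<le> card A" using cardA by simp
    then have "(s + s div 2) * (card T + card M) \<le> (s + s div 2) * card A"
      by (rule mult_le_mono2)
    \<comment> \<open>Counting incidences: a point has degree at most 1 unless it is in
      \<open>X\<close>. The matching bound then pays for \<open>card X\<close>.\<close>
    moreover have "s * card A \<le> card U + card X"
    proof -
      have "s * card A = (\<Sum>e\<in>A. card {u \<in> U. u \<in> e})"
      proof -
        have "{u \<in> U. u \<in> e} = e" if "e \<in> A" for e using that sub by auto
        then have "(\<Sum>e\<in>A. card {u \<in> U. u \<in> e}) = (\<Sum>e\<in>A. s)"
          using unif by (intro sum.cong) auto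
        then show ?thesis by simp
      qed
      also have "\<dots> = (\<Sum>u\<in>U. card {e \<in> A. u \<in> e})"
        using fin by (intro double_count)
      also have "\<dots> \<le> (\<Sum>u\<in>U. 1 + (if u \<in> X then 1 else 0))"
      proof (rule sum_mono)
        fix u assume "u \<in> U"
        then show "card {e \<in> A. u \<in> e} \<le> 1 + (if u \<in> X then 1 else 0)"
          using deg[of u] by (auto simp: X_def)
      qed
      also have "\<dots> = card U + card (U \<inter> X)"
        unfolding sum.distrib using fin by (simp add: sum.If_cases)
      finally show ?thesis by (simp add: X_def Int_def conj_ac)
    qed
    ultimately show ?thesis using M(2) unfolding add_mult_distrib add_mult_distrib2 by linarith
  qed
  ultimately show ?thesis by blast
qed

lemma small_transversal:
  assumes "finite U" "finite A" "\<Union>A \<subseteq> U" "\<And>e. e \<in> A \<Longrightarrow> card e = s" "s > 0"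
  shows "\<exists>T\<subseteq>U. (\<forall>e\<in>A. T \<inter> e \<noteq> {}) \<and> (s + s div 2) * card T \<le> card U + s div 2 * card A"
  using assms
proof (induction "card A" arbitrary: A U rule: less_induct)
  case less
  note fin = less.prems(1,2) and sub = less.prems(3) and unif = less.prems(4)
  show ?case
  proof (cases "\<forall>u. card {e \<in> A. u \<in> e} \<le> 2")
    case True
    then show ?thesis
      using small_transversal_degree_2[OF fin sub unif] less.prems(5) by blast
  next
    case False
    then obtain u where u: "3 \<le> card {e \<in> A. u \<in> e}"
      by (metis not_less_eq_eq numeral_2_eq_2 numeral_3_eq_3)
    define A' where "A' = {e \<in> A. u \<notin> e}"
    have "A = {e \<in> A. u \<in> e} \<union> A'" by (auto simp: A'_def)
    then have "card A = card {e \<in> A. u \<in> e} + card A'"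
      using fin(2) card_Un_disjoint[of "{e \<in> A. u \<in> e}" A'] by (auto simp: A'_def)
    then have cardA: "card A' + 3 \<le> card A" using u by simp
    have "{e \<in> A. u \<in> e} \<noteq> {}" using u by (metis card.empty not_numeral_le_zero)
    then have "u \<in> U" using sub by auto
    have "\<exists>T\<subseteq>U - {u}. (\<forall>e\<in>A'. T \<inter> e \<noteq> {}) \<and>
        (s + s div 2) * card T \<le> card (U - {u}) + s div 2 * card A'"
      using cardA fin sub unif less.prems(5)
      by (intro less.hyps) (auto simp: A'_def)
    then obtain T where T: "T \<subseteq> U - {u}" "\<And>e. e \<in> A' \<Longrightarrow> T \<inter> e \<noteq> {}"
      "(s + s div 2) * card T \<le> card (U - {u}) + s div 2 * card A'" by blast
    have "finite T" using T(1) fin(1) finite_subset by blast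
    then have "(s + s div 2) * card (insert u T) \<le> (s + s div 2) + (s + s div 2) * card T"
      by (simp add: card_insert_if)
    also have "\<dots> \<le> (s + s div 2) + (card U - 1) + s div 2 * card A'"
      using T(3) \<open>u \<in> U\<close> by simp
    \<comment> \<open>Here \<open>s \<le> 2 * (s div 2) + 1\<close>, so the loss of one point and
      three sets pays for \<open>u\<close>.\<close>
    also have "\<dots> \<le> card U + s div 2 * (card A' + 3)"
    proof -
      have "1 \<le> card U" using \<open>u \<in> U\<close> fin(1) by (metis One_nat_def Suc_leI card_gt_0_iff empty_iff)
      then show ?thesis by (simp add: algebra_simps)
    qed
    also have "\<dots> \<le> card U + s div 2 * card A"
      using cardA by simp
    finally have "(s + s div 2) * card (insert u T) \<le> card U + s div 2 * card A" .
    moreover have "insert u T \<subseteq> U" using T(1) \<open>u \<in> U\<close> by blast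
    moreover have "insert u T \<inter> e \<noteq> {}" if "e \<in> A" for e
      using T(2)[of e] that by (cases "u \<in> e") (auto simp: A'_def)
    ultimately show ?thesis by blast
  qed
qed

subsection \<open>Stalled sets and private neighbors\<close>

text \<open>The side condition of \<open>forcing_step\<close>, freed from the blue set so that it
  can be applied to whole or private neighborhoods.\<close>

definition coverable :: "'a set set \<Rightarrow> nat \<Rightarrow> 'a \<Rightarrow> 'a set \<Rightarrow> bool" where
  "coverable E k v Z \<longleftrightarrow>
     (\<exists>F\<subseteq>E. finite F \<and> card F \<le> k \<and> (\<forall>e\<in>F. v \<in> e) \<and> Z \<subseteq> \<Union>F)"

text \<open>A fixed-point view of forcing: the blue set finally reached from a set is the least
  stalled set containing it, so the order of the forces is irrelevant.\<close>

definition stalled :: "'a set \<Rightarrow> 'a set set \<Rightarrow> nat \<Rightarrow> 'a set \<Rightarrow> bool" where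
  "stalled V E k C \<longleftrightarrow>
     C \<subseteq> V \<and> (\<forall>v\<in>C. coverable E k v (neighbors E v - C) \<longrightarrow> neighbors E v \<subseteq> C)"

definition private_neighbors :: "'a set set \<Rightarrow> 'a set \<Rightarrow> 'a \<Rightarrow> 'a set" where
  "private_neighbors E S v = {w \<in> neighbors E v - S. \<forall>u\<in>S - {v}. w \<notin> neighbors E u}"

lemma coverable_subset: "coverable E k v Z \<Longrightarrow> Z' \<subseteq> Z \<Longrightarrow> coverable E k v Z'"
  unfolding coverable_def by (meson subset_trans)

lemma neighbors_sym: "u \<in> neighbors E v \<longleftrightarrow> v \<in> neighbors E u"
  by (auto simp: neighbors_def adjacent_def)

lemma neighbors_irrefl: "v \<notin> neighbors E v"
  by (simp add: neighbors_def adjacent_def)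

lemma neighbors_subset: "hypergraph V E \<Longrightarrow> neighbors E v \<subseteq> V"
  by (auto simp: hypergraph_def neighbors_def adjacent_def)

lemma edge_subset_neighbors: "e \<in> E \<Longrightarrow> v \<in> e \<Longrightarrow> e \<subseteq> insert v (neighbors E v)"
  by (auto simp: neighbors_def adjacent_def)

lemma stalled_forces:
  "stalled V E k C \<Longrightarrow> v \<in> C \<Longrightarrow> coverable E k v (neighbors E v - C) \<Longrightarrow> neighbors E v \<subseteq> C"
  by (simp add: stalled_def)

text \<open>Forcing is monotone: fewer white neighbors are still coverable, so blue vertices never
  leave a stalled set containing the initial one. Conversely, a reachable set of largest size is
  stalled.\<close>

lemma power_dominating_iff:
  assumes "hypergraph V E"
  shows "power_dominating V E k D \<longleftrightarrow>
    D \<subseteq> V \<and> (\<forall>C. stalled V E k C \<and> closed_neighborhood E D \<subseteq> C \<longrightarrow> C = V)"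
proof (intro iffI conjI allI impI)
  assume D: "power_dominating V E k D"
  then show "D \<subseteq> V" by (simp add: power_dominating_def)
  fix C assume C: "stalled V E k C \<and> closed_neighborhood E D \<subseteq> C"
  have "(forcing_step E k)\<^sup>*\<^sup>* (closed_neighborhood E D) V"
    using D by (simp add: power_dominating_def)
  then have "V \<subseteq> C"
  proof induction
    case base
    then show ?case using C by blast
  next
    case (step B B')
    then obtain v where v: "v \<in> B" "coverable E k v (neighbors E v - B)"
      "B' = B \<union> (neighbors E v - B)"
      by (auto simp: forcing_step_def coverable_def)
    have "coverable E k v (neighbors E v - C)"
      using coverable_subset[OF v(2)] step.IH by blast
    then have "neighbors E v \<subseteq> C" using C v(1) step.IH stalled_forces[of V E k C v] by blast
    then show ?case using v(3) step.IH by blast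
  qed
  then show "C = V" using C by (simp add: stalled_def subset_antisym)
next
  assume D: "D \<subseteq> V \<and> (\<forall>C. stalled V E k C \<and> closed_neighborhood E D \<subseteq> C \<longrightarrow> C = V)"
  have finV: "finite V" using assms by (simp add: hypergraph_def)
  let ?N = "closed_neighborhood E D"
  let ?P = "\<lambda>B. (forcing_step E k)\<^sup>*\<^sup>* ?N B \<and> ?N \<subseteq> B \<and> B \<subseteq> V"
  have "?N \<subseteq> V"
    using D neighbors_subset[OF assms] by (auto simp: closed_neighborhood_def)
  then have "?P ?N" by simp
  moreover have "\<forall>B. ?P B \<longrightarrow> card B < Suc (card V)"
    using finV by (simp add: card_mono less_Suc_eq_le)
  ultimately have "\<exists>B. ?P B \<and> (\<forall>B'. ?P B' \<longrightarrow> card B' \<le> card B)"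
    by (rule ex_has_greatest_nat)
  then obtain B where B: "?P B" and best: "\<And>B'. ?P B' \<Longrightarrow> card B' \<le> card B" by blast
  have "neighbors E v \<subseteq> B" if v: "v \<in> B" "coverable E k v (neighbors E v - B)" for v
  proof -
    let ?B' = "B \<union> (neighbors E v - B)"
    have "forcing_step E k B ?B'"
      using v by (auto simp: forcing_step_def coverable_def)
    then have "?P ?B'"
      using B neighbors_subset[OF assms, of v] by (auto intro: rtranclp.rtrancl_into_rtrancl)
    then have "card ?B' \<le> card B" and "finite ?B'"
      using best finV finite_subset by blast+
    then have "B = ?B'" by (intro card_seteq) auto
    then show ?thesis by blast
  qed
  then have "stalled V E k B" using B by (simp add: stalled_def)
  then have "B = V" using D B by blast
  then show "power_dominating V E k D" using B D by (simp add: power_dominating_def)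
qed

lemma power_domination_number_le:
  "power_dominating V E k D \<Longrightarrow> power_domination_number V E k \<le> card D"
  unfolding power_domination_number_def by (rule Least_le) blast

lemma power_domination_number_attained:
  assumes "hypergraph V E"
  shows "\<exists>D. power_dominating V E k D \<and> card D = power_domination_number V E k"
  unfolding power_domination_number_def
  by (rule LeastI_ex) (use power_dominating_vertices[OF assms] in blast)

section \<open>Exchanging vertices of a minimum power dominating set\<close>

lemma power_dominating_replace:
  assumes H: "hypergraph V E" and S: "power_dominating V E k S" and D: "D \<subseteq> V" "S - {v} \<subseteq> D"
    and v: "\<And>C. stalled V E k C \<Longrightarrow> closed_neighborhood E D \<subseteq> C \<Longrightarrow> v \<in> C \<and> neighbors E v \<subseteq> C"
  shows "power_dominating V E k D"
  unfolding power_dominating_iff[OF H]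
proof (intro conjI allI impI D(1))
  fix C assume C: "stalled V E k C \<and> closed_neighborhood E D \<subseteq> C"
  then have "closed_neighborhood E S \<subseteq> C"
    using v[of C] D(2) unfolding closed_neighborhood_def by blast
  then show "C = V" using C S by (simp add: power_dominating_iff[OF H])
qed

text \<open>A vertex of \<open>S\<close> violating the claim has no neighbor in \<open>S\<close>. It can be exchanged for a
  neighbor that it shares with another vertex of \<open>S\<close> or, if there is none, for the nearest vertex
  whose neighborhood is not coverable. The first exchange increases the number of vertices of \<open>S\<close>
  with a neighbor in \<open>S\<close>; the second does not decrease it and increases the number of vertices of
  \<open>S\<close> whose neighborhood is not coverable.\<close>

lemma minimum_power_dominating_private:
  assumes H: "hypergraph V E" and conn: "connected_hypergraph V E"
    and b: "b \<in> V" "\<not> coverable E k b (neighbors E b)"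
  shows "\<exists>S. power_dominating V E k S \<and> card S = power_domination_number V E k \<and>
    (\<forall>v\<in>S. \<not> coverable E k v (private_neighbors E S v))"
proof -
  have finV: "finite V" using H by (simp add: hypergraph_def)
  let ?min = "\<lambda>S. power_dominating V E k S \<and> card S = power_domination_number V E k"
  define touching where "touching S = {v \<in> S. neighbors E v \<inter> S \<noteq> {}}" for S
  define large where "large S = {v \<in> S. \<not> coverable E k v (neighbors E v)}" for S
  \<comment> \<open>Lexicographic order as one number: \<open>card (large S)\<close> never reaches
    the weight \<open>Suc (card V)\<close>.\<close>
  let ?f = "\<lambda>S. card (touching S) * Suc (card V) + card (large S)"
  have subV: "S \<subseteq> V" if "?min S" for S using that by (simp add: power_dominating_def)
  have le_card: "card (touching S) \<le> card V" "card (large S) \<le> card V" if "S \<subseteq> V" for S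
    using that finV by (auto simp: touching_def large_def intro!: card_mono)
  obtain S0 where "?min S0" using power_domination_number_attained[OF H] by blast
  moreover have "\<forall>S. ?min S \<longrightarrow> ?f S < Suc (card V * Suc (card V) + card V)"
    by (metis add_le_mono le_card less_Suc_eq_le mult_le_mono1 subV)
  ultimately have "\<exists>S. ?min S \<and> (\<forall>S'. ?min S' \<longrightarrow> ?f S' \<le> ?f S)"
    by (rule ex_has_greatest_nat)
  then obtain S where S: "?min S" and best: "\<And>S'. ?min S' \<Longrightarrow> ?f S' \<le> ?f S" by blast
  have SV: "S \<subseteq> V" using subV S by blast
  then have finS: "finite S" using finV finite_subset by blast
  have "\<not> coverable E k v (private_neighbors E S v)" if vS: "v \<in> S" for v
  proof
    assume cov: "coverable E k v (private_neighbors E S v)"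
    \<comment> \<open>Once \<open>S - {v}\<close> and its neighbors are blue, only private neighbors
      of \<open>v\<close> can be white, and these are coverable.\<close>
    have forced: "neighbors E v \<subseteq> C"
      if C: "stalled V E k C" "closed_neighborhood E D \<subseteq> C" "v \<in> C" "S - {v} \<subseteq> D" for C D
    proof -
      have "neighbors E v - C \<subseteq> private_neighbors E S v"
        using C(2-4) neighbors_irrefl[of v E]
        unfolding private_neighbors_def closed_neighborhood_def by blast
      then show ?thesis using stalled_forces[OF C(1,3)] coverable_subset[OF cov] by blast
    qed
    have not_dom: "\<not> power_dominating V E k (S - {v})"
      using power_domination_number_le[of V E k "S - {v}"] S vS finS
        card_Diff1_less[OF finS vS] by auto
    have iso: "neighbors E v \<inter> S = {}"
    proof (rule ccontr)
      assume "neighbors E v \<inter> S \<noteq> {}"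
      then obtain w where w: "w \<in> S - {v}" "v \<in> neighbors E w"
        using neighbors_irrefl neighbors_sym by fastforce
      have "power_dominating V E k (S - {v})"
      proof (rule power_dominating_replace[OF H, of k S _ v])
        fix C assume C: "stalled V E k C" "closed_neighborhood E (S - {v}) \<subseteq> C"
        then have "v \<in> C" using w unfolding closed_neighborhood_def by blast
        then show "v \<in> C \<and> neighbors E v \<subseteq> C" using forced[OF C] by blast
      qed (use S SV in auto)
      then show False using not_dom by blast
    qed
    have exchange: "?f (insert u (S - {v})) \<le> ?f S \<and> u \<notin> S"
      if u: "u \<in> V" "u \<noteq> v" and D: "power_dominating V E k (insert u (S - {v}))" for u
    proof -
      \<comment> \<open>Otherwise the new set would be \<open>S - {v}\<close>, contradicting
        minimality.\<close>
      have "u \<notin> S" using D not_dom u(2) by (metis Diff_iff insert_absorb singletonD)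
      moreover from this have "card (insert u (S - {v})) = card S"
        by (metis DiffD1 card_Suc_Diff1 card_insert_disjoint finS finite_Diff vS)
      ultimately show ?thesis using best D S by simp
    qed
    show False
    proof (cases "neighbors E v \<subseteq> private_neighbors E S v")
      case False
      then obtain u w where uw: "u \<in> neighbors E v" "w \<in> S - {v}" "u \<in> neighbors E w"
        using iso unfolding private_neighbors_def by blast
      let ?D = "insert u (S - {v})"
      have "u \<in> V" "u \<noteq> v" using uw neighbors_subset[OF H] neighbors_irrefl by fast+
      moreover have "power_dominating V E k ?D"
      proof (rule power_dominating_replace[OF H, of k S _ v])
        fix C assume C: "stalled V E k C" "closed_neighborhood E ?D \<subseteq> C"
        have "v \<in> neighbors E u" using uw(1) neighbors_sym by fast
        then have "v \<in> C" using C(2) unfolding closed_neighborhood_def by blast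
        then show "v \<in> C \<and> neighbors E v \<subseteq> C" using forced[OF C] by blast
      qed (use S SV \<open>u \<in> V\<close> in auto)
      ultimately have ex: "?f ?D \<le> ?f S" "u \<notin> S" using exchange by blast+
      have "w \<in> neighbors E u" using uw(3) neighbors_sym by fast
      \<comment> \<open>As \<open>v\<close> has no neighbor in \<open>S\<close>, removing it takes
        no partner away from the others, and \<open>u\<close> is adjacent to
        \<open>w\<close>.\<close>
      then have "insert u (touching S) \<subseteq> touching ?D"
        using iso uw(2) neighbors_sym[of v E] unfolding touching_def by blast
      moreover have "finite (touching ?D)" "u \<notin> touching S" "finite (touching S)"
        using finS ex(2) by (auto simp: touching_def)
      ultimately have "Suc (card (touching S)) \<le> card (touching ?D)"
        by (metis card_insert_disjoint card_mono)
      then have "Suc (card (touching S)) * Suc (card V) \<le> card (touching ?D) * Suc (card V)"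
        by (rule mult_le_mono1)
      then show False using ex(1) le_card(2)[OF SV] by simp
    next
      case True
      then have small: "coverable E k v (neighbors E v)" using coverable_subset[OF cov] by blast
      \<comment> \<open>On a path from \<open>b\<close> to \<open>v\<close>, let \<open>u\<close> be
        the last vertex with an uncoverable neighborhood. From \<open>u\<close>, forcing runs along
        the rest of the path and reaches \<open>v\<close>.\<close>
      let ?R = "\<lambda>x y. adjacent E x y \<and> coverable E k y (neighbors E y)"
      have "(adjacent E)\<^sup>*\<^sup>* b v" using conn b(1) vS SV by (auto simp: connected_hypergraph_def)
      then have "\<exists>u\<in>V. \<not> coverable E k u (neighbors E u) \<and> ?R\<^sup>*\<^sup>* u v"
      proof (induction rule: rtranclp_induct)
        case base
        then show ?case using b by blast
      next
        case (step y z)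
        show ?case
        proof (cases "coverable E k z (neighbors E z)")
          case True
          obtain u where "u \<in> V" "\<not> coverable E k u (neighbors E u)" "?R\<^sup>*\<^sup>* u y"
            using step.IH by blast
          moreover have "?R y z" using True step.hyps(2) by blast
          ultimately show ?thesis by (blast intro: rtranclp.rtrancl_into_rtrancl)
        next
          case False
          moreover have "z \<in> V" using step.hyps(2) neighbors_subset[OF H, of y]
            by (auto simp: neighbors_def)
          ultimately show ?thesis by blast
        qed
      qed
      then obtain u where u: "u \<in> V" "\<not> coverable E k u (neighbors E u)" "?R\<^sup>*\<^sup>* u v" by blast
      let ?D = "insert u (S - {v})"
      have "u \<noteq> v" using u(2) small by blast
      moreover have "power_dominating V E k ?D"
      proof (rule power_dominating_replace[OF H, of k S _ v])
        fix C assume C: "stalled V E k C" "closed_neighborhood E ?D \<subseteq> C"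
        show "v \<in> C \<and> neighbors E v \<subseteq> C"
          using u(3)
        proof (induction rule: rtranclp_induct)
          case base
          then show ?case using C(2) unfolding closed_neighborhood_def by blast
        next
          case (step y z)
          then have "z \<in> C" by (auto simp: neighbors_def)
          moreover have "coverable E k z (neighbors E z - C)"
            using step.hyps(2) by (blast intro: coverable_subset)
          ultimately show ?case using stalled_forces[OF C(1)] by blast
        qed
      qed (use S SV u(1) in auto)
      ultimately have ex: "?f ?D \<le> ?f S" "u \<notin> S" using exchange u(1) by blast+
      have "touching S \<subseteq> touching ?D"
        using iso neighbors_sym[of v E] unfolding touching_def by blast
      then have "card (touching S) * Suc (card V) \<le> card (touching ?D) * Suc (card V)"
        using finS by (intro mult_le_mono1 card_mono) (auto simp: touching_def)
      moreover have "large ?D = insert u (large S)" "u \<notin> large S" "finite (large S)"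
        using u(2) small ex(2) finS by (auto simp: large_def)
      ultimately show False using ex(1) by simp
    qed
  qed
  then show ?thesis using S by blast
qed

subsection \<open>The bound\<close>

text \<open>Redundant edges are discarded one by one; an edge that cannot be discarded is the only
  one to cover some point of \<open>Z\<close>.\<close>

lemma minimal_cover:
  assumes "finite G" "Z \<subseteq> \<Union>G"
  shows "\<exists>M\<subseteq>G. Z \<subseteq> \<Union>M \<and> (\<forall>e\<in>M. \<exists>z\<in>Z \<inter> e. \<forall>f\<in>M. z \<in> f \<longrightarrow> f = e)"
  using assms
proof (induction G rule: finite_psubset_induct)
  case (psubset G)
  show ?case
  proof (cases "\<exists>e\<in>G. Z \<subseteq> \<Union>(G - {e})")
    case True
    then obtain e where "e \<in> G" "Z \<subseteq> \<Union>(G - {e})" by blast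
    moreover have "G - {e} \<subset> G" using \<open>e \<in> G\<close> by blast
    ultimately show ?thesis using psubset.IH[of "G - {e}"] by (meson order_trans psubset_imp_subset)
  next
    case False
    have "\<exists>z\<in>Z \<inter> e. \<forall>f\<in>G. z \<in> f \<longrightarrow> f = e" if "e \<in> G" for e
    proof -
      have "\<not> Z \<subseteq> \<Union>(G - {e})" using False that by blast
      then obtain z where z: "z \<in> Z" "z \<notin> \<Union>(G - {e})" by blast
      then have "z \<in> e" using psubset.prems by blast
      then show ?thesis using z by blast
    qed
    then show ?thesis using psubset.prems by blast
  qed
qed

text \<open>The vertices of \<open>S\<close> are processed one at a time. The neighbors of \<open>v\<close> that are outside \<open>S\<close>,
  not yet covered by \<open>A\<close> and not adjacent to a later vertex of \<open>S\<close> are covered by a minimal set of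
  edges at \<open>v\<close>; \<open>k\<close> of these are set aside, to be used when \<open>v\<close> forces, and the others join \<open>A\<close>.
  Every edge that is set aside contributes to \<open>X\<close> a vertex covered by it alone. Forcing runs in
  the opposite order: the vertex processed last forces first.\<close>

definition forcing_system ::
  "'a set \<Rightarrow> 'a set set \<Rightarrow> nat \<Rightarrow> 'a set \<Rightarrow> 'a set \<Rightarrow> 'a set set \<Rightarrow> 'a set \<Rightarrow> bool" where
  "forcing_system V E k S S' A X \<longleftrightarrow>
    A \<subseteq> E \<and> X \<subseteq> V \<and> card X = k * card S' \<and> X \<inter> \<Union>A = {} \<and> X \<inter> S = {} \<and>
    S' \<subseteq> \<Union>A \<and> (\<forall>e\<in>A. e \<inter> S' \<noteq> {}) \<and>
    X \<inter> (\<Union>u\<in>S - S'. neighbors E u) = {} \<and>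
    (\<forall>e\<in>A. \<exists>y\<in>e - S - (\<Union>u\<in>S - S'. neighbors E u). \<forall>f\<in>A. y \<in> f \<longrightarrow> f = e) \<and>
    (\<forall>C. stalled V E k C \<and> \<Union>A \<subseteq> C \<and> closed_neighborhood E (S - S') \<subseteq> C
       \<longrightarrow> closed_neighborhood E S \<subseteq> C)"

lemma forcing_system_exists:
  assumes H: "hypergraph V E" and SV: "S \<subseteq> V"
    and priv: "\<And>v. v \<in> S \<Longrightarrow> \<not> coverable E k v (private_neighbors E S v)"
    and S': "finite S'" "S' \<subseteq> S"
  shows "\<exists>A X. forcing_system V E k S S' A X"
  using S'
proof (induction S' rule: finite_subset_induct')
  case empty
  have "forcing_system V E k S {} {} {}" by (simp add: forcing_system_def)
  then show ?case by blast
next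
  case (insert v S')
  let ?later = "\<lambda>S'. \<Union>u\<in>S - S'. neighbors E u"
  obtain A X where IH: "forcing_system V E k S S' A X" using insert.IH by blast
  then have AE: "A \<subseteq> E" and XV: "X \<subseteq> V" and cardX: "card X = k * card S'"
    and XA: "X \<inter> \<Union>A = {}" and XS: "X \<inter> S = {}" and S'A: "S' \<subseteq> \<Union>A"
    and AS': "\<And>e. e \<in> A \<Longrightarrow> e \<inter> S' \<noteq> {}" and Xlater: "X \<inter> ?later S' = {}"
    and own: "\<And>e. e \<in> A \<Longrightarrow> \<exists>y\<in>e - S - ?later S'. \<forall>f\<in>A. y \<in> f \<longrightarrow> f = e"
    and force: "\<And>C. stalled V E k C \<Longrightarrow> \<Union>A \<subseteq> C \<Longrightarrow> closed_neighborhood E (S - S') \<subseteq> C \<Longrightarrow>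
      closed_neighborhood E S \<subseteq> C"
    unfolding forcing_system_def by simp_all
  have finV: "finite V" and finE: "finite E"
    using H by (auto simp: hypergraph_def intro: finite_subset)
  have finX: "finite X" using XV finV finite_subset by blast
  define P where "P = neighbors E v - S - ?later (insert v S') - \<Union>A"
  have "P \<subseteq> \<Union>{e \<in> E. v \<in> e}" by (auto simp: P_def neighbors_def adjacent_def)
  then obtain M where M: "M \<subseteq> {e \<in> E. v \<in> e}" "P \<subseteq> \<Union>M"
    and ownM: "\<And>e. e \<in> M \<Longrightarrow> \<exists>z\<in>P \<inter> e. \<forall>f\<in>M. z \<in> f \<longrightarrow> f = e"
    using minimal_cover[of "{e \<in> E. v \<in> e}" P] finE by auto
  have finM: "finite M" using M(1) finE by (auto intro: finite_subset)
  \<comment> \<open>Each edge of \<open>A\<close> contains a vertex of \<open>S\<close> other than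
    \<open>v\<close>, hence no private neighbor of \<open>v\<close>. So \<open>P\<close> is
    uncoverable and \<open>M\<close> has more than \<open>k\<close> edges.\<close>
  have "private_neighbors E S v \<subseteq> P"
  proof
    fix w assume w: "w \<in> private_neighbors E S v"
    have "w \<notin> e" if e: "e \<in> A" for e
    proof
      assume "w \<in> e"
      obtain u where u: "u \<in> e" "u \<in> S'" using AS'[OF e] by blast
      then have "w \<in> insert u (neighbors E u)"
        using edge_subset_neighbors[of e E u] e AE \<open>w \<in> e\<close> by blast
      moreover have "u \<in> S - {v}" using u insert.hyps by blast
      ultimately show False using w by (auto simp: private_neighbors_def)
    qed
    then show "w \<in> P" using w by (auto simp: P_def private_neighbors_def)
  qed
  then have "\<not> coverable E k v P"
    using priv[OF insert.hyps(2)] coverable_subset[of E k v P] by blast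
  then have "\<not> card M \<le> k" using M finM unfolding coverable_def by blast
  then obtain F where F: "F \<subseteq> M" "card F = k" "finite F"
    using obtain_subset_with_card_n[of k M] by (metis nat_le_linear)
  obtain z where z: "\<And>e. e \<in> M \<Longrightarrow> z e \<in> P \<inter> e"
    and z_own: "\<And>e f. e \<in> M \<Longrightarrow> f \<in> M \<Longrightarrow> z e \<in> f \<Longrightarrow> f = e"
    using ownM by metis
  \<comment> \<open>At least one edge is left after setting \<open>F\<close> aside, so
    \<open>v\<close> is blue as soon as the new family is.\<close>
  define B where "B = M - F"
  have "M \<noteq> F" using F(2) \<open>\<not> card M \<le> k\<close> by auto
  then have "B \<noteq> {}" using F(1) by (auto simp: B_def)
  have BE: "B \<subseteq> E" and vB: "\<And>e. e \<in> B \<Longrightarrow> v \<in> e" using M(1) by (auto simp: B_def)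
  have B_nbrs: "e \<subseteq> insert v (neighbors E v)" if "e \<in> B" for e
    using edge_subset_neighbors[of e E v] BE vB that by blast
  have old_later: "neighbors E v \<subseteq> ?later S'" "?later (insert v S') \<subseteq> ?later S'"
    using insert.hyps by auto
  have vS: "v \<in> S" "v \<notin> S'" using insert.hyps by auto
  \<comment> \<open>The new edges lie in the closed neighborhood of \<open>v\<close>, a later vertex
    from the viewpoint of \<open>S'\<close>. Hence they miss \<open>X\<close> and the vertices owned
    by the old edges.\<close>
  have B_avoids: "y \<notin> \<Union>B" if "y \<notin> S" "y \<notin> ?later S'" for y
    using that B_nbrs old_later vS(1) by blast
  define Y where "Y = z ` F"
  have "inj_on z F" using z z_own F(1) unfolding inj_on_def by (metis IntE subsetD)
  then have cardY: "card Y = k" using F(2) by (simp add: Y_def card_image)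
  have YP: "Y \<subseteq> P" using z F(1) by (auto simp: Y_def)
  have "Y \<inter> \<Union>B = {}"
    using z_own F(1) by (fastforce simp: Y_def B_def)
  have PX: "P \<inter> X = {}" using Xlater old_later by (auto simp: P_def)
  have "forcing_system V E k S (insert v S') (A \<union> B) (X \<union> Y)"
    unfolding forcing_system_def
  proof (intro conjI)
    show "A \<union> B \<subseteq> E" using AE BE by blast
    show "X \<union> Y \<subseteq> V" using XV YP neighbors_subset[OF H, of v] by (auto simp: P_def)
    have "card (X \<union> Y) = card X + card Y"
      using finX F(3) PX YP by (intro card_Un_disjoint) (auto simp: Y_def)
    then show "card (X \<union> Y) = k * card (insert v S')"
      using cardX cardY vS(2) insert.hyps(1) by simp
    have "X \<inter> \<Union>B = {}" using B_avoids XS Xlater by blast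
    moreover have "Y \<inter> \<Union>A = {}" using YP by (auto simp: P_def)
    ultimately show "(X \<union> Y) \<inter> \<Union>(A \<union> B) = {}"
      using XA \<open>Y \<inter> \<Union>B = {}\<close> by blast
    show "(X \<union> Y) \<inter> S = {}" using XS YP by (auto simp: P_def)
    show "insert v S' \<subseteq> \<Union>(A \<union> B)" using S'A vB \<open>B \<noteq> {}\<close> by blast
    show "\<forall>e\<in>A \<union> B. e \<inter> insert v S' \<noteq> {}" using AS' vB by blast
    show "(X \<union> Y) \<inter> ?later (insert v S') = {}"
      using Xlater old_later(2) YP by (auto simp: P_def)
    show "\<forall>e\<in>A \<union> B. \<exists>y\<in>e - S - ?later (insert v S'). \<forall>f\<in>A \<union> B. y \<in> f \<longrightarrow> f = e"
    proof
      fix e assume "e \<in> A \<union> B"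
      then consider "e \<in> A" | "e \<in> B" by blast
      then show "\<exists>y\<in>e - S - ?later (insert v S'). \<forall>f\<in>A \<union> B. y \<in> f \<longrightarrow> f = e"
      proof cases
        case 1
        then obtain y where y: "y \<in> e - S - ?later S'" "\<forall>f\<in>A. y \<in> f \<longrightarrow> f = e"
          using own by blast
        then have "y \<notin> \<Union>B" using B_avoids by blast
        then show ?thesis using y old_later(2) by (intro bexI[of _ y]) blast+
      next
        case 2
        then have "e \<in> M" by (simp add: B_def)
        then have "z e \<in> P \<inter> e" "\<forall>f\<in>M. z e \<in> f \<longrightarrow> f = e" using z z_own by blast+
        then show ?thesis by (intro bexI[of _ "z e"]) (auto simp: P_def B_def)
      qed
    qed
    show "\<forall>C. stalled V E k C \<and> \<Union>(A \<union> B) \<subseteq> C \<and> closed_neighborhood E (S - insert v S') \<subseteq> C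
       \<longrightarrow> closed_neighborhood E S \<subseteq> C"
    proof (intro allI impI)
      fix C
      assume C: "stalled V E k C \<and> \<Union>(A \<union> B) \<subseteq> C \<and> closed_neighborhood E (S - insert v S') \<subseteq> C"
      have later: "S - insert v S' \<subseteq> C" "?later (insert v S') \<subseteq> C"
        using C unfolding closed_neighborhood_def by blast+
      have "v \<in> C" using C vB \<open>B \<noteq> {}\<close> by blast
      then have "S \<subseteq> C" using later(1) S'A C by blast
      \<comment> \<open>White neighbors of \<open>v\<close> lie in \<open>P\<close>, and those in
        edges of \<open>B\<close> are already blue. The \<open>k\<close> edges of \<open>F\<close>
        cover the rest, so \<open>v\<close> forces and the induction hypothesis applies.\<close>
      then have "neighbors E v - C \<subseteq> P" using C later(2) unfolding P_def by blast
      moreover have "P - \<Union>B \<subseteq> \<Union>F" using M(2) by (auto simp: B_def)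
      ultimately have "neighbors E v - C \<subseteq> \<Union>F" using C by blast
      then have "coverable E k v (neighbors E v - C)"
        using F M(1) unfolding coverable_def by (intro exI[of _ F]) auto
      then have "neighbors E v \<subseteq> C" using C \<open>v \<in> C\<close> stalled_forces[of V E k C v] by blast
      then have "closed_neighborhood E (S - S') \<subseteq> C"
        using \<open>v \<in> C\<close> later unfolding closed_neighborhood_def by blast
      then show "closed_neighborhood E S \<subseteq> C" using force C by blast
    qed
  qed
  then show ?case by blast
qed

section \<open>From the forcing system to the inequality\<close>

lemma delete_private_vertices:
  assumes finA: "finite A" and fin: "\<And>e. e \<in> A \<Longrightarrow> finite e"
    and y: "\<And>e. e \<in> A \<Longrightarrow> y e \<in> e" "\<And>e f. e \<in> A \<Longrightarrow> f \<in> A \<Longrightarrow> y e \<in> f \<Longrightarrow> f = e"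
  shows "card (\<Union>A - y ` A) + card A = card (\<Union>A)"
proof -
  have "inj_on y A" using y unfolding inj_on_def by metis
  then have "card (y ` A) = card A" by (rule card_image)
  moreover have "finite (\<Union>A)" "y ` A \<subseteq> \<Union>A" using finA fin y(1) by auto
  ultimately show ?thesis
    using card_mono[of "\<Union>A" "y ` A"] by (simp add: card_Diff_subset finite_subset)
qed

lemma power_domination_bound_large:
  assumes r: "r \<ge> 3" and H: "hypergraph V E" and conn: "connected_hypergraph V E"
    and unif: "uniform r E" and b: "b \<in> V" "\<not> coverable E k b (neighbors E b)"
  shows "(r + (r - 3) div 2 + k) * power_domination_number V E k \<le> card V + (r - 3) div 2 * card E"
proof -
  define g where "g = power_domination_number V E k"
  define h where "h = (r - 1) div 2"
  have finV: "finite V" and finE: "finite E"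
    using H by (auto simp: hypergraph_def intro: finite_subset)
  obtain S where S: "power_dominating V E k S" "card S = g"
    and priv: "\<And>v. v \<in> S \<Longrightarrow> \<not> coverable E k v (private_neighbors E S v)"
    using minimum_power_dominating_private[OF H conn b] unfolding g_def by blast
  have SV: "S \<subseteq> V" using S(1) by (simp add: power_dominating_def)
  then have finS: "finite S" using finV finite_subset by blast
  obtain A X where sys: "forcing_system V E k S S A X"
    using forcing_system_exists[OF H SV priv finS subset_refl] by blast
  then have AE: "A \<subseteq> E" and XV: "X \<subseteq> V" and cardX: "card X = k * g" and XA: "X \<inter> \<Union>A = {}"
    using S(2) by (simp_all add: forcing_system_def)
  have own: "\<exists>y\<in>e. \<forall>f\<in>A. y \<in> f \<longrightarrow> f = e" if "e \<in> A" for e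
  proof -
    have "\<exists>y\<in>e - S - (\<Union>u\<in>S - S. neighbors E u). \<forall>f\<in>A. y \<in> f \<longrightarrow> f = e"
      using sys that unfolding forcing_system_def by blast
    then show ?thesis by blast
  qed
  have force: "closed_neighborhood E S \<subseteq> C" if "stalled V E k C" "\<Union>A \<subseteq> C" for C
  proof -
    have "closed_neighborhood E (S - S) \<subseteq> C" by (simp add: closed_neighborhood_def)
    then show ?thesis using sys that unfolding forcing_system_def by blast
  qed
  obtain y where y: "\<And>e. e \<in> A \<Longrightarrow> y e \<in> e" "\<And>e f. e \<in> A \<Longrightarrow> f \<in> A \<Longrightarrow> y e \<in> f \<Longrightarrow> f = e"
    using own by metis
  have finA: "finite A" using AE finE finite_subset by blast
  have AV: "\<Union>A \<subseteq> V" using AE H by (auto simp: hypergraph_def)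
  have fine: "finite e" if "e \<in> A" for e using that AV finV by (meson Sup_upper finite_subset)
  define U where "U = \<Union>A - y ` A"
  \<comment> \<open>An owned vertex lies in no other edge, so each edge loses exactly one vertex and
    the remainders avoid all deleted vertices.\<close>
  define A' where "A' = (\<lambda>e. e - {y e}) ` A"
  have "\<exists>T\<subseteq>U. (\<forall>e\<in>A'. T \<inter> e \<noteq> {}) \<and>
      (r - 1 + (r - 1) div 2) * card T \<le> card U + (r - 1) div 2 * card A'"
  proof (rule small_transversal)
    show "finite U" "finite A'" using finA fine by (auto simp: U_def A'_def)
    show "\<Union>A' \<subseteq> U" using y by (fastforce simp: U_def A'_def)
    show "card e = r - 1" if "e \<in> A'" for e
      using that y(1) fine AE unif by (auto simp: A'_def uniform_def)
  qed (use r in simp)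
  then obtain T where T: "T \<subseteq> U" "\<And>e. e \<in> A' \<Longrightarrow> T \<inter> e \<noteq> {}"
    "(r - 1 + h) * card T \<le> card U + h * card A'" unfolding h_def by blast
  have "power_dominating V E k T"
    unfolding power_dominating_iff[OF H]
  proof (intro conjI allI impI)
    show "T \<subseteq> V" using T(1) AV by (auto simp: U_def)
    fix C assume C: "stalled V E k C \<and> closed_neighborhood E T \<subseteq> C"
    have "e \<subseteq> C" if e: "e \<in> A" for e
    proof -
      obtain t where "t \<in> T" "t \<in> e" using T(2)[of "e - {y e}"] e by (auto simp: A'_def)
      then show ?thesis using edge_subset_neighbors[of e E t] e AE C
        unfolding closed_neighborhood_def by blast
    qed
    then have "closed_neighborhood E S \<subseteq> C" using force C by blast
    then show "C = V" using C S(1) by (simp add: power_dominating_iff[OF H])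
  qed
  then have "g \<le> card T" unfolding g_def by (rule power_domination_number_le)
  then have "(r - 1 + h) * g \<le> (r - 1 + h) * card T" by (rule mult_le_mono2)
  moreover have "card U + card A = card (\<Union>A)"
    unfolding U_def using finA fine y by (rule delete_private_vertices)
  moreover have "card (\<Union>A) + k * g \<le> card V"
  proof -
    have "card (X \<union> \<Union>A) = card X + card (\<Union>A)"
      using XV AV finV XA by (intro card_Un_disjoint) (auto intro: finite_subset)
    moreover have "card (X \<union> \<Union>A) \<le> card V" using XV AV finV by (intro card_mono) auto
    ultimately show ?thesis using cardX by simp
  qed
  \<comment> \<open>Different edges may coincide after the deletion, hence only an
    inequality.\<close>
  moreover have "h * card A' \<le> h * card A"
    unfolding A'_def using card_image_le[OF finA] by (intro mult_le_mono2)
  ultimately have "(r - 1 + h) * g + k * g + card A \<le> card V + h * card A"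
    using T(3) by linarith
  \<comment> \<open>The \<open>card A\<close> deleted vertices lower the coefficient of
    \<open>card A\<close> from \<open>h\<close> to \<open>(r - 3) div 2\<close>.\<close>
  moreover have h: "h = Suc ((r - 3) div 2)" "r - 1 + h = r + (r - 3) div 2"
    using r by (simp_all add: h_def)
  ultimately have "(r + (r - 3) div 2) * g + k * g \<le> card V + (r - 3) div 2 * card A"
    by simp
  also have "\<dots> \<le> card V + (r - 3) div 2 * card E"
    using card_mono[OF finE AE] by simp
  finally show ?thesis by (simp add: g_def add_mult_distrib)
qed

text \<open>Every vertex can force at once, so blue spreads from \<open>z\<close> along every
  path.\<close>

lemma power_domination_number_le_1:
  assumes H: "hypergraph V E" and conn: "connected_hypergraph V E" and z: "z \<in> V"
    and cov: "\<And>v. v \<in> V \<Longrightarrow> coverable E k v (neighbors E v)"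
  shows "power_domination_number V E k \<le> 1"
proof -
  have "power_dominating V E k {z}"
    unfolding power_dominating_iff[OF H]
  proof (intro conjI allI impI)
    fix C assume C: "stalled V E k C \<and> closed_neighborhood E {z} \<subseteq> C"
    have "v \<in> C" if "v \<in> V" for v
    proof -
      have "(adjacent E)\<^sup>*\<^sup>* z v" using conn z that by (simp add: connected_hypergraph_def)
      then show ?thesis
      proof (induction rule: rtranclp_induct)
        case base
        then show ?case using C by (auto simp: closed_neighborhood_def)
      next
        case (step x y)
        have "x \<in> V" using step.IH C by (auto simp: stalled_def)
        then have "coverable E k x (neighbors E x - C)"
          using coverable_subset[OF cov] by blast
        then have "neighbors E x \<subseteq> C" using C step.IH stalled_forces[of V E k C x] by blast
        then show ?case using step.hyps(2) by (auto simp: neighbors_def)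
      qed
    qed
    then show "C = V" using C by (auto simp: stalled_def)
  qed (use z in simp)
  then show ?thesis using power_domination_number_le by fastforce
qed

lemma connected_hypergraph_edges_nonempty:
  assumes "connected_hypergraph V E" "card V \<ge> 2"
  shows "E \<noteq> {}"
proof
  assume "E = {}"
  obtain u v where "u \<in> V" "v \<in> V" "u \<noteq> v"
    using assms(2) by (metis card_2_iff insert_subset obtain_subset_with_card_n)
  then have "(adjacent E)\<^sup>*\<^sup>* u v" using assms(1) by (simp add: connected_hypergraph_def)
  then show False
    using \<open>u \<noteq> v\<close> \<open>E = {}\<close> by (cases rule: converse_rtranclpE) (auto simp: adjacent_def)
qed

theorem theorem3p7:
  fixes V :: "'a set" and E :: "'a set set" and r k n m :: nat
  assumes "r \<ge> 3"
    and "hypergraph V E"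
    and "connected_hypergraph V E"
    and "uniform r E"
    and "card V = n"
    and "card E = m"
    and "k + r \<le> n"
  shows "real (power_domination_number V E k)
    \<le> (real n + real_of_int \<lfloor>(real r - 3) / 2\<rfloor> * real m)
        / (real_of_int \<lfloor>3 * (real r - 1) / 2\<rfloor> + real k)"
proof -
  define g where "g = power_domination_number V E k"
  define c where "c = (r - 3) div 2"
  have "finite E" using assms(2) by (auto simp: hypergraph_def intro: finite_subset)
  have "(r + c + k) * g \<le> n + c * m"
  proof (cases "\<forall>v\<in>V. coverable E k v (neighbors E v)")
    case True
    have "V \<noteq> {}" using assms(1,5,7) by auto
    then have "g \<le> 1"
      unfolding g_def using power_domination_number_le_1[OF assms(2,3)] True by blast
    then have "(r + c + k) * g \<le> r + c + k" by (cases g) auto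
    \<comment> \<open>One edge pays for \<open>c\<close>, and \<open>k + r \<le> n\<close> pays for
      the rest.\<close>
    moreover have "1 \<le> m"
      using connected_hypergraph_edges_nonempty[OF assms(3)] assms(1,5-7) \<open>finite E\<close>
      by (simp add: Suc_le_eq card_gt_0_iff assms(6)[symmetric])
    then have "c \<le> c * m" by simp
    ultimately show ?thesis using assms(7) by linarith
  next
    case False
    then show ?thesis
      using power_domination_bound_large[OF assms(1-4)] assms(5,6) unfolding g_def c_def by blast
  qed
  then have "real (r + c + k) * real g \<le> real n + real c * real m"
    by (metis of_nat_add of_nat_le_iff of_nat_mult)
  \<comment> \<open>With \<open>d\<close> the parity of \<open>r - 3\<close>, the fractions are
    \<open>c + d/2\<close> and \<open>3 * c + 3 + 3 * d/2\<close>. As \<open>d \<le> 1\<close>, the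
    latter rounds down to \<open>3 * c + 3 + d = r + c\<close>.\<close>
  moreover obtain d where d: "r = 2 * c + 3 + d" "d \<le> 1"
  proof
    show "r = 2 * c + 3 + (r - 3) mod 2" using assms(1) by (simp add: c_def)
  qed simp
  have "\<lfloor>(real r - 3) / 2\<rfloor> = int c" "\<lfloor>3 * (real r - 1) / 2\<rfloor> = int (r + c)"
    using d by (auto intro!: floor_unique)
  ultimately show ?thesis
    using assms(1) by (simp add: g_def pos_le_divide_eq algebra_simps)
qed

end
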